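(* Let $e_1$ and $e_2$ be positive integers. Then there is at most one even integer $r\geq 2$ such that $\frac{e_2}{e_1}=\frac{q_{n+1,r}}{q_{n,r}}$ for some $n\in\mathbb{Z}$ (with $q_{n,r}\ne 0$). If $r\geq 8$, then the value of $n$ is also unique.
   Context: For each even $r\geq 2$ the sequence $\{q_{n,r}\}_{n\in\mathbb{Z}}$ is determined by $q_{-1,r}=1$, $q_{0,r}=0$, $q_{1,r}=1$ and, for all $n\in\mathbb{Z}$, $q_{n,r}=\frac{r-2}{2}(q_{n-1,r}-q_{n-2,r})+q_{n-3,r}$. *)

theory Defs
  imports Complex_Main
begin

text \<open>
  The bi-infinite integer sequence of index \<open>r\<close>, meant for even \<open>r\<close> (so that the division
  by two is exact). The two-sided recurrence is run forwards from \<open>-1, 0, 1\<close> for \<open>n > 1\<close>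
  and solved for its last term, i.e. run backwards, for \<open>n < -1\<close>.
\<close>

function q :: "int \<Rightarrow> int \<Rightarrow> int" where
  "q r n =
    (if n = -1 then 1
     else if n = 0 then 0
     else if n = 1 then 1
     else if n > 1 then (r - 2) div 2 * (q r (n - 1) - q r (n - 2)) + q r (n - 3)
     else q r (n + 3) - (r - 2) div 2 * (q r (n + 2) - q r (n + 1)))"
  by auto
termination
  by (relation "measure (\<lambda>(r, n). nat \<bar>n\<bar>)") auto

declare q.simps [simp del]

lemma q_initial: "q r (-1) = 1" "q r 0 = 0" "q r 1 = 1"
  by (simp_all add: q.simps)

lemma q_recurrence:
  "q r n = (r - 2) div 2 * (q r (n - 1) - q r (n - 2)) + q r (n - 3)"
proof (cases "n > 1")
  case True
  then show ?thesis by (subst q.simps) simp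
next
  case False
  then have "q r (n - 3) = q r n - (r - 2) div 2 * (q r (n - 1) - q r (n - 2))"
    by (subst q.simps) simp
  then show ?thesis by simp
qed

lemma q_unique:
  fixes f :: "int \<Rightarrow> int"
  assumes init: "f (-1) = 1" "f 0 = 0" "f 1 = 1"
    and rec: "\<And>n. f n = (r - 2) div 2 * (f (n - 1) - f (n - 2)) + f (n - 3)"
  shows "f = q r"
proof
  fix n
  show "f n = q r n"
  proof (induction "nat \<bar>n\<bar>" arbitrary: n rule: less_induct)
    case less
    consider "n = -1 \<or> n = 0 \<or> n = 1" | "n > 1" | "n < -1" by linarith
    then show ?case
    proof cases
      case 1
      then show ?thesis by (auto simp: init q_initial)
    next
      case 2
      then have "f (n - 1) = q r (n - 1)" "f (n - 2) = q r (n - 2)" "f (n - 3) = q r (n - 3)"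
        by (auto intro!: less)
      then show ?thesis by (metis rec q_recurrence)
    next
      case 3
      then have "f (n + 1) = q r (n + 1)" "f (n + 2) = q r (n + 2)" "f (n + 3) = q r (n + 3)"
        by (auto intro!: less)
      with rec [of "n + 3"] q_recurrence [of r "n + 3"] show ?thesis by (simp add: add.commute)
    qed
  qed
qed

end

theory Submission
  imports Defs
begin

text \<open>
  Write \<open>r = 2 * s\<close>. Since \<open>1\<close> is a root of the characteristic polynomial, the recurrence drops to
  order two, and the resulting conserved quadratic form says that consecutive terms \<open>x, y\<close>
  satisfy \<open>(x + y - 1)\<^sup>2 = s * x * y\<close>. Hence all terms are nonnegative and consecutive ones
  are coprime, so the ratio \<open>y / x\<close> determines \<open>(x, y)\<close>, which in turn determines \<open>s\<close>. For \<open>s \<ge> 4\<close> the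
  differences \<open>y - x\<close> increase strictly along the sequence, so \<open>(x, y)\<close> determines the index too.
\<close>

text \<open>The third-order recurrence says exactly that
  \<open>q (n + 1) - (s - 2) * q n + q (n - 1)\<close> does not change with \<open>n\<close>; at
  \<open>n = 0\<close> it equals 2.\<close>

lemma q_recurrence_order_two:
  "q (2 * s) (n + 1) = (s - 2) * q (2 * s) n - q (2 * s) (n - 1) + 2"
proof (induction n rule: int_induct [where k = 0])
  case base
  show ?case by (simp add: q_initial)
next
  case (step1 n)
  with q_recurrence [of "2 * s" "n + 2"] show ?case by (simp add: algebra_simps)
next
  case (step2 n)
  with q_recurrence [of "2 * s" "n + 1"] show ?case by (simp add: algebra_simps)
qed

text \<open>Vieta jumping: for fixed \<open>y\<close>, the roots of
  \<open>(x + y - 1)\<^sup>2 = s * x * y\<close> in \<open>x\<close> have sum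
  \<open>(s - 2) * y + 2\<close>, so the order-two recurrence exchanges the two neighbours of
  \<open>y\<close> as roots.\<close>

lemma q_invariant:
  "(q (2 * s) n + q (2 * s) (n + 1) - 1)\<^sup>2 = s * q (2 * s) n * q (2 * s) (n + 1)"
proof (induction n rule: int_induct [where k = 0])
  case base
  show ?case by (simp add: q_initial)
next
  case (step1 n)
  moreover have "q (2 * s) (n + 1 + 1) = (s - 2) * q (2 * s) (n + 1) - q (2 * s) n + 2"
    using q_recurrence_order_two [of s "n + 1"] by simp
  ultimately show ?case by algebra
next
  case (step2 n)
  moreover have "q (2 * s) (n - 1) = (s - 2) * q (2 * s) n - q (2 * s) (n + 1) + 2"
    using q_recurrence_order_two [of s n] by simp
  ultimately have "(q (2 * s) (n - 1) + q (2 * s) n - 1)\<^sup>2 = s * q (2 * s) (n - 1) * q (2 * s) n"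
    by algebra
  then show ?case by simp
qed

lemma nonneg_neighbour:
  fixes s x y :: int
  assumes "s > 0" "(x + y - 1)\<^sup>2 = s * x * y" "x \<ge> 0"
  shows "y \<ge> 0"
proof (cases "x = 0")
  case True
  \<comment> \<open>The relation reduces to \<open>(y - 1)\<^sup>2 = 0\<close>, so
    \<open>y = 1\<close>.\<close>
  with assms(2) show ?thesis by simp
next
  case False
  with assms have "s * x > 0" by simp
  moreover have "(s * x) * y \<ge> 0" using assms(2) by (metis zero_le_power2)
  ultimately show ?thesis by (simp add: zero_le_mult_iff)
qed

lemma q_nonneg:
  assumes "s > 0"
  shows "q (2 * s) n \<ge> 0"
proof (induction n rule: int_induct [where k = 0])
  case base
  show ?case by (simp add: q_initial)
next
  case (step1 n)
  with nonneg_neighbour [OF assms q_invariant] show ?case by blast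
next
  case (step2 n)
  \<comment> \<open>The invariant is symmetric in its two terms, so nonnegativity also propagates
    backwards.\<close>
  have "(q (2 * s) n + q (2 * s) (n - 1) - 1)\<^sup>2 = s * q (2 * s) n * q (2 * s) (n - 1)"
    using q_invariant [of s "n - 1"] by (simp add: algebra_simps)
  with nonneg_neighbour [OF assms] step2 show ?case by blast
qed

lemma coprime_q_consecutive: "coprime (q (2 * s) n) (q (2 * s) (n + 1))"
proof (rule coprimeI)
  fix d
  let ?x = "q (2 * s) n" and ?y = "q (2 * s) (n + 1)"
  assume "d dvd ?x" "d dvd ?y"
  \<comment> \<open>Expanding the square in the invariant and isolating its constant term gives this
    Bezout identity.\<close>
  moreover have "1 = ?x * (s * ?y - ?x - 2 * ?y + 2) + ?y * (2 - ?y)"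
    using q_invariant [of s n] by algebra
  ultimately show "is_unit d" by (metis dvd_add dvd_mult2)
qed

lemma coprime_pos_fraction_unique:
  fixes x y x' y' :: int
  assumes "coprime x y" "coprime x' y'" "x > 0" "x' > 0"
    and "rat_of_int y / rat_of_int x = rat_of_int y' / rat_of_int x'"
  shows "x = x' \<and> y = y'"
proof -
  have "rat_of_int (y * x') = rat_of_int (y' * x)"
    using assms by (simp add: field_simps)
  then have eq: "y * x' = y' * x" by (simp only: of_int_eq_iff)
  have "x dvd x'" using assms(1) eq by (metis coprime_dvd_mult_right_iff dvd_triv_right)
  moreover have "x' dvd x" using assms(2) eq by (metis coprime_dvd_mult_right_iff dvd_triv_right)
  ultimately have "x = x'" using assms by (simp add: zdvd_antisym_nonneg)
  with eq assms show ?thesis by simp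
qed

text \<open>Both fractions are in lowest terms with positive denominators. Allowing \<open>s\<close>
  and \<open>t\<close> to differ serves the uniqueness of \<open>r\<close>; taking
  \<open>s = t\<close> serves that of \<open>n\<close>.\<close>

lemma q_ratio_determines_pair:
  assumes "s > 0" "t > 0" "q (2 * s) m \<noteq> 0" "q (2 * t) n \<noteq> 0"
    and "rat_of_int (q (2 * s) (m + 1)) / rat_of_int (q (2 * s) m) =
         rat_of_int (q (2 * t) (n + 1)) / rat_of_int (q (2 * t) n)"
  shows "q (2 * s) m = q (2 * t) n" "q (2 * s) (m + 1) = q (2 * t) (n + 1)"
proof -
  have "q (2 * s) m > 0" "q (2 * t) n > 0"
    using assms q_nonneg [of s m] q_nonneg [of t n] by auto
  with coprime_pos_fraction_unique [OF coprime_q_consecutive coprime_q_consecutive] assms(5)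
  show "q (2 * s) m = q (2 * t) n" "q (2 * s) (m + 1) = q (2 * t) (n + 1)" by blast+
qed

text \<open>By the order-two recurrence, the increment of the difference from \<open>n\<close> to
  \<open>n + 1\<close> is \<open>(s - 4) * q (2 * s) (n + 1) + 2\<close>, which is at least
  2.\<close>

lemma q_diff_strict_mono:
  assumes "s \<ge> 4"
  shows "strict_mono (\<lambda>n. q (2 * s) (n + 1) - q (2 * s) n)"
proof (rule strict_monoI)
  fix m n :: int
  assume "m < n"
  then show "q (2 * s) (m + 1) - q (2 * s) m < q (2 * s) (n + 1) - q (2 * s) n"
  proof (induction n rule: int_gr_induct)
    case base
    have "(s - 4) * q (2 * s) (m + 1) \<ge> 0"
      using assms q_nonneg [of s "m + 1"] by simp
    with q_recurrence_order_two [of s "m + 1"] show ?case by (simp add: algebra_simps)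
  next
    case (step n)
    have "(s - 4) * q (2 * s) (n + 1) \<ge> 0"
      using assms q_nonneg [of s "n + 1"] by simp
    with q_recurrence_order_two [of s "n + 1"] step show ?case by (simp add: algebra_simps)
  qed
qed

theorem theorem6p10:
  fixes e1 e2 :: int
  assumes "e1 > 0" and "e2 > 0"
  shows "(\<exists>\<^sub>\<le>\<^sub>1 r. even r \<and> r \<ge> 2 \<and>
            (\<exists>n. q r n \<noteq> 0 \<and>
              rat_of_int e2 / rat_of_int e1 = rat_of_int (q r (n + 1)) / rat_of_int (q r n)))
       \<and> (\<forall>r. even r \<and> r \<ge> 8 \<longrightarrow>
            (\<exists>\<^sub>\<le>\<^sub>1 n. q r n \<noteq> 0 \<and>
              rat_of_int e2 / rat_of_int e1 = rat_of_int (q r (n + 1)) / rat_of_int (q r n)))"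
proof (intro conjI allI impI)
  have unique: "s = t"
    if "s > 0" "t > 0" "q (2 * s) m \<noteq> 0" "q (2 * t) n \<noteq> 0"
      and s: "rat_of_int e2 / rat_of_int e1 = rat_of_int (q (2 * s) (m + 1)) / rat_of_int (q (2 * s) m)"
      and t: "rat_of_int e2 / rat_of_int e1 = rat_of_int (q (2 * t) (n + 1)) / rat_of_int (q (2 * t) n)"
    for s t m n
  proof -
    note pair = q_ratio_determines_pair [OF that(1-4) trans [OF s [symmetric] t]]
    \<comment> \<open>The ratio is positive, so its numerator does not vanish and the product of the
      pair can be cancelled below.\<close>
    have "q (2 * t) (n + 1) \<noteq> 0" using t assms by auto
    moreover have "s * (q (2 * t) n * q (2 * t) (n + 1)) = t * (q (2 * t) n * q (2 * t) (n + 1))"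
      using q_invariant [of s m] q_invariant [of t n] pair by (auto simp add: mult.assoc)
    ultimately show ?thesis using that by simp
  qed
  show "\<exists>\<^sub>\<le>\<^sub>1 r. even r \<and> r \<ge> 2 \<and>
            (\<exists>n. q r n \<noteq> 0 \<and>
              rat_of_int e2 / rat_of_int e1 = rat_of_int (q r (n + 1)) / rat_of_int (q r n))"
  proof (rule Uniq_I, elim conjE exE evenE)
    fix r r' m n s t
    assume "r \<ge> 2" "r' \<ge> 2" "r = 2 * s" "r' = 2 * t" "q r m \<noteq> 0" "q r' n \<noteq> 0"
      and "rat_of_int e2 / rat_of_int e1 = rat_of_int (q r (m + 1)) / rat_of_int (q r m)"
      and "rat_of_int e2 / rat_of_int e1 = rat_of_int (q r' (n + 1)) / rat_of_int (q r' n)"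
    then show "r = r'" using unique [of s t m n] by simp
  qed
next
  fix r :: int
  assume "even r \<and> r \<ge> 8"
  then obtain s where r: "r = 2 * s" and s: "s \<ge> 4" by (auto elim!: evenE)
  show "\<exists>\<^sub>\<le>\<^sub>1 n. q r n \<noteq> 0 \<and>
              rat_of_int e2 / rat_of_int e1 = rat_of_int (q r (n + 1)) / rat_of_int (q r n)"
    unfolding r
  proof (rule Uniq_I, elim conjE)
    fix m n
    assume "q (2 * s) m \<noteq> 0" "q (2 * s) n \<noteq> 0"
      and "rat_of_int e2 / rat_of_int e1 = rat_of_int (q (2 * s) (m + 1)) / rat_of_int (q (2 * s) m)"
      and "rat_of_int e2 / rat_of_int e1 = rat_of_int (q (2 * s) (n + 1)) / rat_of_int (q (2 * s) n)"
    then have "q (2 * s) m = q (2 * s) n" "q (2 * s) (m + 1) = q (2 * s) (n + 1)"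
      using q_ratio_determines_pair [of s s m n] s by simp_all
    \<comment> \<open>Equal pairs have equal differences. A single term would not suffice, since the
      value 1 occurs at both -1 and 1.\<close>
    then show "m = n"
      using strict_mono_eq [OF q_diff_strict_mono [OF s], of m n] by simp
  qed
qed

end
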